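(* Let $\mathbb{F}$ be a field of characteristic $c$, let $M \in \mathbb{F}^{r \times n}$, and let $A,B \subseteq [n]$ with $|A|=|B|=r$. Let $X \subseteq A \setminus B$, $Y \subseteq B \setminus A$, and let $p$ be an integer with $|Y| \le p \le |X|$. Suppose that $c=0$ or $\binom{|X|-i}{|X|-p} \not\equiv 0 \pmod c$ for all $0 \le i \le |Y|$. Then $$\mu^M_{A, B}(\emptyset, \emptyset) = \sum_{k=0}^{|Y|} \sum_{i=0}^{|Y|-k} \frac{\binom{|X\cup Y|-|A\setminus B|-i-1}{|Y|-k-i}}{\binom{|X|-i}{|X|-p}} \sum_{\substack{U \subseteq A\setminus B,\ |U|=p+k,\ |U \cap X| = p \\ V \subseteq B\setminus A,\ |V|=p+k,\ Y \subseteq V}} \mu^M_{A, B}(U, V).$$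
   Context: $[n]=\{1,\dots,n\}$. For $J\subseteq[n]$, $M[J]$ is the submatrix of $M$ consisting of the columns indexed by $J$ in increasing order. For $A\subseteq[n]$, $X = \{x_1< \dotsb< x_k\} \subseteq A$ and $Y = \{y_1< \dotsb< y_k\} \subseteq [n] \setminus A$, $M[A; -X, +Y]$ denotes the matrix obtained from $M[A]$ by replacing, for each $i$, the column $x_i$ by the column $y_i$ (placed in the position of $x_i$); similarly, for $B\subseteq[n]$, $X\subseteq[n]\setminus B$, $Y\subseteq B$ with $|X|=|Y|$, $M[B; +X, -Y]$ is obtained from $M[B]$ by replacing column $y_i$ by column $x_i$ in the position of $y_i$. For $A,B$ with $|A|=|B|=r$, $X\subseteq A\setminus B$, $Y\subseteq B\setminus A$ with $|X|=|Y|$, define $\mu^M_{A,B}(X,Y) := \det M[A; -X, +Y]\cdot\det M[B; +X, -Y]$; so $\mu^M_{A,B}(\emptyset,\emptyset)=\det M[A]\det M[B]$. Binomial coefficients are generalized: for integers $n,k$, $\binom{n}{k} = n(n-1)\cdots(n-k+1)/k!$ if $k\ge 0$ and $0$ if $k<0$ (so $n$ may be negative); rational coefficients are interpreted in $\mathbb{F}$. *)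

theory Defs
  imports
    "Jordan_Normal_Form.Determinant"
    "Jordan_Normal_Form.DL_Submatrix"
    "HOL-Computational_Algebra.Computational_Algebra"
    "HOL-Number_Theory.Cong"
begin

text \<open>
  Columns are indexed from 0, so that the index set $[n]$ becomes \<open>{0..<n}\<close>; the order of the
  columns is unchanged.  The submatrix $M[J]$ is \<open>submatrix M UNIV J\<close>, and \<open>pick J j\<close> is the
  \<open>j\<close>-th smallest element of \<open>J\<close> (counting from 0).
\<close>

text \<open>
  The map $x_i \mapsto y_i$ for $X = \{x_1 < \dots < x_k\}$ and $Y = \{y_1 < \dots < y_k\}$,
  extended by the identity outside \<open>X\<close>.  The position of \<open>x\<close> in \<open>X\<close> is the number of smaller
  elements of \<open>X\<close>.
\<close>

definition exchange_index :: "nat set \<Rightarrow> nat set \<Rightarrow> nat \<Rightarrow> nat" where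
  "exchange_index X Y a = (if a \<in> X then pick Y (card {x \<in> X. x < a}) else a)"

text \<open>
  \<open>exchange_cols M J Out In\<close> is $M[J; -\mathit{Out}, +\mathit{In}]$, that is, $M[J]$ with the
  \<open>i\<close>-th column of \<open>Out\<close> replaced by the \<open>i\<close>-th column of \<open>In\<close>.  It covers both notations:
  $M[A; -X, +Y]$ is \<open>exchange_cols M A X Y\<close> and $M[B; +X, -Y]$ is \<open>exchange_cols M B Y X\<close>.
\<close>

definition exchange_cols :: "'a mat \<Rightarrow> nat set \<Rightarrow> nat set \<Rightarrow> nat set \<Rightarrow> 'a mat" where
  "exchange_cols M J Out In =
     mat (dim_row M) (card J) (\<lambda>(i, j). M $$ (i, exchange_index Out In (pick J j)))"

lemma exchange_cols_empty:
  assumes "J \<subseteq> {0..<dim_col M}"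
  shows "exchange_cols M J {} {} = submatrix M UNIV J"
proof -
  have "{j. j < dim_col M \<and> j \<in> J} = J"
    using assms by auto
  then show ?thesis
    by (simp add: exchange_cols_def exchange_index_def submatrix_def pick_UNIV)
qed

definition mu :: "'a::comm_ring_1 mat \<Rightarrow> nat set \<Rightarrow> nat set \<Rightarrow> nat set \<Rightarrow> nat set \<Rightarrow> 'a" where
  "mu M A B X Y = det (exchange_cols M A X Y) * det (exchange_cols M B Y X)"

lemma mu_empty:
  assumes "A \<subseteq> {0..<dim_col M}" "B \<subseteq> {0..<dim_col M}"
  shows "mu M A B {} {} = det (submatrix M UNIV A) * det (submatrix M UNIV B)"
  using assms by (simp add: mu_def exchange_cols_empty)

text \<open>
  Generalized binomial coefficients with integer values: \<open>n\<close> may be negative and the division is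
  exact.  The \<open>gchoose\<close> input syntax is not available at type \<^typ>\<open>int\<close> under these imports; the lemma
  below identifies the two.
\<close>

definition int_binom :: "int \<Rightarrow> int \<Rightarrow> int" where
  "int_binom n k = (if k < 0 then 0 else (\<Prod>j = 0..<nat k. n - int j) div fact (nat k))"

lemma of_int_int_binom:
  "of_int (int_binom n (int k)) = (of_int n :: 'a::field_char_0) gchoose k"
  by (simp add: int_binom_def flip: of_int_gbinomial gbinomial_prod_rev)

end

theory Submission
  imports Defs "Jordan_Normal_Form.Char_Poly"
begin

text \<open>
  Both sides are polynomials in the entries of \<open>M\<close>, so one may assume that \<open>M[A]\<close> is invertible, and
  after a row transformation that it is scalar.  Then \<open>mu M A B U V\<close> is, up to a fixed factor, the
  part of the expansion of \<open>det M[B]\<close> into permutations consisting of the terms that map \<open>V\<close> to \<open>U\<close>.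
  Hence the claim holds as soon as it holds term by term: for every bijection \<open>\<pi>\<close> from \<open>A - B\<close> to
  \<open>B - A\<close>, the coefficients of the pairs \<open>(U, \<pi> ` U)\<close> add up to 1.  If \<open>t\<close> is the number of elements
  of \<open>X\<close> that \<open>\<pi>\<close> maps into \<open>Y\<close>, then Vandermonde's identity, applied to the sum over \<open>k\<close>, leaves
  only the summand \<open>i = t\<close>, which is 1.
\<close>

section \<open>Exchanging columns of two square matrices\<close>

definition mix_cols :: "nat set \<Rightarrow> 'a mat \<Rightarrow> 'a mat \<Rightarrow> 'a mat" where
  "mix_cols U P Q =
     mat (dim_row P) (dim_col P) (\<lambda>(i, j). if j \<in> U then Q $$ (i, j) else P $$ (i, j))"

definition permute_cols :: "(nat \<Rightarrow> nat) \<Rightarrow> 'a mat \<Rightarrow> 'a mat" where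
  "permute_cols \<kappa> Q = mat (dim_row Q) (dim_col Q) (\<lambda>(i, j). Q $$ (i, \<kappa> j))"

definition perm_term :: "nat set \<Rightarrow> 'a::comm_ring_1 mat \<Rightarrow> (nat \<Rightarrow> nat) \<Rightarrow> 'a" where
  "perm_term J Q \<rho> = signof \<rho> * (\<Prod>j\<in>J. Q $$ (\<rho> j, j))"

definition exchange_prod :: "(nat \<Rightarrow> nat) \<Rightarrow> nat set \<Rightarrow> 'a::comm_ring_1 mat \<Rightarrow> 'a mat \<Rightarrow> 'a" where
  "exchange_prod \<kappa> U P Q =
     signof \<kappa> * (det (mix_cols U P (permute_cols \<kappa> Q)) * det (mix_cols U (permute_cols \<kappa> Q) P))"

lemma mix_cols_carrier [simp]: "P \<in> carrier_mat m n \<Longrightarrow> mix_cols U P Q \<in> carrier_mat m n"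
  by (intro carrier_matI) (auto simp: mix_cols_def)

lemma permute_cols_carrier [simp]: "Q \<in> carrier_mat m n \<Longrightarrow> permute_cols \<kappa> Q \<in> carrier_mat m n"
  by (intro carrier_matI) (auto simp: permute_cols_def)

lemma mix_cols_swap:
  assumes "P \<in> carrier_mat m n" "Q \<in> carrier_mat m n"
  shows "mix_cols U Q P = mix_cols ({0..<n} - U) P Q"
  using assms by (auto simp: mix_cols_def intro!: eq_matI)

lemma det_mix_cols_scalar:
  fixes Q :: "'a::comm_ring_1 mat"
  assumes Q: "Q \<in> carrier_mat r r" and U: "U \<subseteq> {0..<r}"
  shows "det (mix_cols U (d \<cdot>\<^sub>m 1\<^sub>m r) Q) =
    d ^ card ({0..<r} - U) * (\<Sum>\<sigma> | \<sigma> permutes U. perm_term U Q \<sigma>)"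
proof -
  let ?J = "{0..<r}" and ?N = "mix_cols U (d \<cdot>\<^sub>m 1\<^sub>m r) Q"
  have N: "?N $$ (i, j) = (if j \<in> U then Q $$ (i, j) else if i = j then d else 0)"
    if "i < r" "j < r" for i j
    using that by (simp add: mix_cols_def)
  have "det ?N = (\<Sum>\<sigma> | \<sigma> permutes ?J. signof \<sigma> * (\<Prod>j\<in>?J. ?N $$ (\<sigma> j, j)))"
    by (subst det_col[of _ r]) (simp_all add: atLeast0LessThan)
  also have "\<dots> = (\<Sum>\<sigma> | \<sigma> permutes U. d ^ card (?J - U) * perm_term U Q \<sigma>)"
  proof (rule sum.mono_neutral_cong_right)
    show "finite {\<sigma>. \<sigma> permutes ?J}"
      by (simp add: finite_permutations)
    show "{\<sigma>. \<sigma> permutes U} \<subseteq> {\<sigma>. \<sigma> permutes ?J}"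
      using U permutes_subset by blast
    show "\<forall>\<sigma>\<in>{\<sigma>. \<sigma> permutes ?J} - {\<sigma>. \<sigma> permutes U}.
        signof \<sigma> * (\<Prod>j\<in>?J. ?N $$ (\<sigma> j, j)) = 0"
    proof
      fix \<sigma> assume "\<sigma> \<in> {\<sigma>. \<sigma> permutes ?J} - {\<sigma>. \<sigma> permutes U}"
      then have s: "\<sigma> permutes ?J" "\<not> \<sigma> permutes U" by auto
      then obtain j where j: "j \<in> ?J - U" "\<sigma> j \<noteq> j"
        using permutes_superset[of \<sigma> ?J U] by blast
      moreover have "\<sigma> j < r"
        using permutes_in_image[OF s(1), of j] j by simp
      ultimately have "?N $$ (\<sigma> j, j) = 0"
        by (subst N) auto
      then have "(\<Prod>j\<in>?J. ?N $$ (\<sigma> j, j)) = 0"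
        using j by (intro prod_zero) auto
      then show "signof \<sigma> * (\<Prod>j\<in>?J. ?N $$ (\<sigma> j, j)) = 0"
        by simp
    qed
    fix \<sigma> assume "\<sigma> \<in> {\<sigma>. \<sigma> permutes U}"
    then have s: "\<sigma> permutes U" by simp
    have J: "\<sigma> j < r" if "j < r" for j
      using permutes_in_image[OF permutes_subset[OF s U], of j] that by simp
    have "(\<Prod>j\<in>?J. ?N $$ (\<sigma> j, j)) = (\<Prod>j\<in>?J - U. ?N $$ (\<sigma> j, j)) * (\<Prod>j\<in>U. ?N $$ (\<sigma> j, j))"
      using U by (intro prod.subset_diff) auto
    also have "(\<Prod>j\<in>?J - U. ?N $$ (\<sigma> j, j)) = (\<Prod>j\<in>?J - U. d)"
      using permutes_not_in[OF s] by (intro prod.cong) (auto simp: N J)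
    also have "(\<Prod>j\<in>U. ?N $$ (\<sigma> j, j)) = (\<Prod>j\<in>U. Q $$ (\<sigma> j, j))"
      using U by (intro prod.cong) (auto simp: N J subset_iff)
    finally show "signof \<sigma> * (\<Prod>j\<in>?J. ?N $$ (\<sigma> j, j)) = d ^ card (?J - U) * perm_term U Q \<sigma>"
      by (simp add: perm_term_def mult_ac)
  qed
  finally show ?thesis
    by (simp add: sum_distrib_left)
qed

lemma perm_sum_mult:
  fixes Q :: "'a::comm_ring_1 mat"
  assumes J: "finite J" and U: "U \<subseteq> J"
  shows "(\<Sum>\<sigma> | \<sigma> permutes U. perm_term U Q \<sigma>) * (\<Sum>\<tau> | \<tau> permutes J - U. perm_term (J - U) Q \<tau>) =
    (\<Sum>\<rho> | \<rho> permutes J \<and> \<rho> ` U = U. perm_term J Q \<rho>)"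
proof -
  have fin: "finite U" using J U finite_subset by blast
  have "(\<Sum>\<sigma> | \<sigma> permutes U. perm_term U Q \<sigma>) * (\<Sum>\<tau> | \<tau> permutes J - U. perm_term (J - U) Q \<tau>) =
    (\<Sum>(\<sigma>, \<tau>)\<in>{\<sigma>. \<sigma> permutes U} \<times> {\<tau>. \<tau> permutes J - U}. perm_term U Q \<sigma> * perm_term (J - U) Q \<tau>)"
    by (simp add: sum_product sum.cartesian_product)
  also have "\<dots> = (\<Sum>\<rho> | \<rho> permutes J \<and> \<rho> ` U = U. perm_term J Q \<rho>)"
  proof (rule sum.reindex_bij_witness[of _ "\<lambda>\<rho>. (restrict_id \<rho> U, restrict_id \<rho> (J - U))" "\<lambda>(\<sigma>, \<tau>). \<sigma> \<circ> \<tau>"])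
    fix x assume "x \<in> {\<sigma>. \<sigma> permutes U} \<times> {\<tau>. \<tau> permutes J - U}"
    then obtain \<sigma> \<tau> where x: "x = (\<sigma>, \<tau>)" and s: "\<sigma> permutes U" and t: "\<tau> permutes J - U" by auto
    note s0 = permutes_not_in[OF s] and t0 = permutes_not_in[OF t]
    note s1 = permutes_in_image[OF s] and t1 = permutes_in_image[OF t]
    have tU: "\<tau> j = j" if "j \<in> U" for j using that t0 by simp
    have sJ: "\<sigma> (\<tau> j) = \<tau> j" if "j \<in> J - U" for j using that s0 t1[of j] by simp
    show "(restrict_id ((\<lambda>(\<sigma>, \<tau>). \<sigma> \<circ> \<tau>) x) U, restrict_id ((\<lambda>(\<sigma>, \<tau>). \<sigma> \<circ> \<tau>) x) (J - U)) = x"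
      unfolding x using tU sJ s0 t0 by (auto simp: restrict_id_def fun_eq_iff)
    have "\<sigma> \<circ> \<tau> permutes J"
      using permutes_compose[OF permutes_subset[OF t] permutes_subset[OF s U]] by blast
    moreover have "(\<sigma> \<circ> \<tau>) ` U = U"
    proof -
      have "(\<sigma> \<circ> \<tau>) ` U = \<sigma> ` U"
        using tU by (intro image_cong) auto
      then show ?thesis
        by (simp add: permutes_image[OF s])
    qed
    ultimately show "(\<lambda>(\<sigma>, \<tau>). \<sigma> \<circ> \<tau>) x \<in> {\<rho>. \<rho> permutes J \<and> \<rho> ` U = U}" by (simp add: x)
    have sg: "sign (\<sigma> \<circ> \<tau>) = sign \<sigma> * sign \<tau>"
      using permutes_imp_permutation[OF fin s] permutes_imp_permutation[OF finite_Diff[OF J] t]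
      by (rule sign_compose)
    have "(\<Prod>j\<in>J. Q $$ (\<sigma> (\<tau> j), j)) = (\<Prod>j\<in>J - U. Q $$ (\<sigma> (\<tau> j), j)) * (\<Prod>j\<in>U. Q $$ (\<sigma> (\<tau> j), j))"
      using U J by (intro prod.subset_diff) auto
    also have "\<dots> = (\<Prod>j\<in>J - U. Q $$ (\<tau> j, j)) * (\<Prod>j\<in>U. Q $$ (\<sigma> j, j))"
      using tU sJ by (intro arg_cong2[of _ _ _ _ "(*)"] prod.cong) auto
    finally show "perm_term J Q ((\<lambda>(\<sigma>, \<tau>). \<sigma> \<circ> \<tau>) x) =
        (case x of (\<sigma>, \<tau>) \<Rightarrow> perm_term U Q \<sigma> * perm_term (J - U) Q \<tau>)"
      by (simp add: x perm_term_def sg mult_ac)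
  next
    fix \<rho> assume "\<rho> \<in> {\<rho>. \<rho> permutes J \<and> \<rho> ` U = U}"
    then have r: "\<rho> permutes J" "\<rho> ` U = U" by auto
    have inj: "inj \<rho>" using r(1) by (rule permutes_inj)
    have c: "\<rho> ` (J - U) = J - U"
      using r permutes_image[OF r(1)] inj by (simp add: image_set_diff)
    have 1: "bij_betw \<rho> U U" "bij_betw \<rho> (J - U) (J - U)"
      using inj_on_subset[OF inj subset_UNIV] r c by (simp_all add: bij_betw_def)
    have "restrict_id \<rho> U permutes U" "restrict_id \<rho> (J - U) permutes J - U"
      using 1 by (simp_all add: permutes_restrict_id)
    then show "(restrict_id \<rho> U, restrict_id \<rho> (J - U)) \<in> {\<sigma>. \<sigma> permutes U} \<times> {\<tau>. \<tau> permutes J - U}"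
      by simp
    have "\<rho> x \<notin> U" if "x \<in> J" "x \<notin> U" for x using c that by blast
    then show "(\<lambda>(\<sigma>, \<tau>). \<sigma> \<circ> \<tau>) (restrict_id \<rho> U, restrict_id \<rho> (J - U)) = \<rho>"
      using U permutes_not_in[OF r(1)] by (auto simp: restrict_id_def fun_eq_iff)
  qed
  finally show ?thesis .
qed

lemma exchange_prod_scalar:
  fixes Q :: "'a::comm_ring_1 mat"
  assumes Q: "Q \<in> carrier_mat r r" and U: "U \<subseteq> {0..<r}" and k: "\<kappa> permutes {0..<r}"
  shows "exchange_prod \<kappa> U (d \<cdot>\<^sub>m 1\<^sub>m r) Q =
    d ^ r * (\<Sum>\<rho> | \<rho> permutes {0..<r} \<and> \<rho> ` \<kappa> ` U = U. perm_term {0..<r} Q \<rho>)"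
proof -
  let ?J = "{0..<r}" and ?Q = "permute_cols \<kappa> Q" and ?D = "d \<cdot>\<^sub>m 1\<^sub>m r"
  have Q': "?Q \<in> carrier_mat r r" using Q by simp
  have c: "card (?J - U) + card U = r"
    using card_Diff_subset[of U ?J] card_mono[of ?J U] U finite_subset[OF U] by simp
  have "?J - (?J - U) = U" using U by auto
  moreover have "mix_cols U ?Q ?D = mix_cols (?J - U) ?D ?Q"
    by (rule mix_cols_swap[of _ r]) (use Q' in auto)
  ultimately have D: "det (mix_cols U ?Q ?D) =
      d ^ card U * (\<Sum>\<tau> | \<tau> permutes ?J - U. perm_term (?J - U) ?Q \<tau>)"
    using det_mix_cols_scalar[OF Q', of "?J - U" d] by simp
  have "d ^ r = d ^ card (?J - U) * d ^ card U"
    using c by (simp flip: power_add)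
  then have "det (mix_cols U ?D ?Q) * det (mix_cols U ?Q ?D) =
    d ^ r * ((\<Sum>\<sigma> | \<sigma> permutes U. perm_term U ?Q \<sigma>) * (\<Sum>\<tau> | \<tau> permutes ?J - U. perm_term (?J - U) ?Q \<tau>))"
    unfolding D det_mix_cols_scalar[OF Q' U, of d] by (simp only: mult_ac)
  also have "\<dots> = d ^ r * (\<Sum>\<rho> | \<rho> permutes ?J \<and> \<rho> ` U = U. perm_term ?J ?Q \<rho>)"
    using U by (simp add: perm_sum_mult)
  finally have "exchange_prod \<kappa> U ?D Q =
      d ^ r * (\<Sum>\<rho> | \<rho> permutes ?J \<and> \<rho> ` U = U. signof \<kappa> * perm_term ?J ?Q \<rho>)"
    by (simp add: exchange_prod_def sum_distrib_left mult_ac)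
  also have "(\<Sum>\<rho> | \<rho> permutes ?J \<and> \<rho> ` U = U. signof \<kappa> * perm_term ?J ?Q \<rho>) =
     (\<Sum>\<rho> | \<rho> permutes ?J \<and> \<rho> ` \<kappa> ` U = U. perm_term ?J Q \<rho>)"
  proof (rule sum.reindex_bij_witness[of _ "\<lambda>\<rho>. \<rho> \<circ> \<kappa>" "\<lambda>\<rho>. \<rho> \<circ> inv_into UNIV \<kappa>"])
    note kk = permutes_inverses[OF k]
    fix \<rho> assume "\<rho> \<in> {\<rho>. \<rho> permutes ?J \<and> \<rho> ` U = U}"
    then have r: "\<rho> permutes ?J" "\<rho> ` U = U" by auto
    show "\<rho> \<circ> inv_into UNIV \<kappa> \<circ> \<kappa> = \<rho>" by (simp add: fun_eq_iff kk)
    show "\<rho> \<circ> inv_into UNIV \<kappa> \<in> {\<rho>. \<rho> permutes ?J \<and> \<rho> ` \<kappa> ` U = U}"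
      using r permutes_compose[OF permutes_inv[OF k] r(1)] by (simp add: image_image kk)
    have "sign (\<rho> \<circ> inv_into UNIV \<kappa>) = sign \<rho> * sign \<kappa>"
      using permutes_imp_permutation[OF _ r(1)] permutes_imp_permutation[OF _ k]
      by (simp add: sign_compose sign_inverse permutation_inverse)
    moreover have "(\<Prod>j\<in>?J. Q $$ ((\<rho> \<circ> inv_into UNIV \<kappa>) j, j)) = (\<Prod>j\<in>?J. Q $$ (\<rho> j, \<kappa> j))"
      by (subst prod.permute[OF k]) (simp add: kk)
    moreover have "(\<Prod>j\<in>?J. Q $$ (\<rho> j, \<kappa> j)) = (\<Prod>j\<in>?J. ?Q $$ (\<rho> j, j))"
      using Q permutes_in_image[OF r(1)] by (intro prod.cong) (auto simp: permute_cols_def)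
    ultimately show "perm_term ?J Q (\<rho> \<circ> inv_into UNIV \<kappa>) = signof \<kappa> * perm_term ?J ?Q \<rho>"
      by (simp add: perm_term_def)
  next
    note kk = permutes_inverses[OF k]
    fix \<rho> assume "\<rho> \<in> {\<rho>. \<rho> permutes ?J \<and> \<rho> ` \<kappa> ` U = U}"
    then have r: "\<rho> permutes ?J" "\<rho> ` \<kappa> ` U = U" by auto
    show "\<rho> \<circ> \<kappa> \<circ> inv_into UNIV \<kappa> = \<rho>" by (simp add: fun_eq_iff kk)
    show "\<rho> \<circ> \<kappa> \<in> {\<rho>. \<rho> permutes ?J \<and> \<rho> ` U = U}"
      using r permutes_compose[OF k r(1)] by (simp add: image_image)
  qed
  finally show ?thesis .
qed

lemma weighted_exchange_scalar:
  fixes Q :: "'a::comm_ring_1 mat"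
  assumes Q: "Q \<in> carrier_mat r r" and S: "S \<subseteq> {0..<r}"
    and agree: "\<And>i j. i < r \<Longrightarrow> j \<in> {0..<r} - S \<Longrightarrow> Q $$ (i, j) = (d \<cdot>\<^sub>m 1\<^sub>m r) $$ (i, j)"
    and k: "\<And>U W. U \<subseteq> S \<Longrightarrow> W \<subseteq> S \<Longrightarrow> card U = card W \<Longrightarrow> \<kappa> U W permutes S \<and> \<kappa> U W ` U = W"
    and w: "\<And>\<rho>. \<rho> permutes S \<Longrightarrow> (\<Sum>W\<in>Pow S. w (\<rho> ` W) W) = 1"
  shows "(\<Sum>(U, W)\<in>{(U, W). U \<subseteq> S \<and> W \<subseteq> S \<and> card U = card W}.
      w U W * exchange_prod (\<kappa> U W) U (d \<cdot>\<^sub>m 1\<^sub>m r) Q) = det (d \<cdot>\<^sub>m 1\<^sub>m r) * det Q"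
proof -
  let ?J = "{0..<r}" and ?I = "{(U, W). U \<subseteq> S \<and> W \<subseteq> S \<and> card U = card W}"
  have finS: "finite S" using S finite_subset by blast
  have finI: "finite ?I"
    by (rule finite_subset[of _ "Pow S \<times> Pow S"]) (use finS in auto)
  have finJ: "finite {\<rho>. \<rho> permutes ?J}" by (simp add: finite_permutations)
  have "(\<Sum>(U, W)\<in>?I. w U W * exchange_prod (\<kappa> U W) U (d \<cdot>\<^sub>m 1\<^sub>m r) Q) =
    (\<Sum>(U, W)\<in>?I. d ^ r * (\<Sum>\<rho> | \<rho> permutes ?J. if \<rho> ` W = U then w U W * perm_term ?J Q \<rho> else 0))"
  proof (rule sum.cong[OF refl], clarify)
    fix U W assume a: "U \<subseteq> S" "W \<subseteq> S" "card U = card W"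
    have p: "\<kappa> U W permutes ?J" "\<kappa> U W ` U = W" "U \<subseteq> ?J"
      using k[OF a] S a permutes_subset by auto
    have "(\<Sum>\<rho> | \<rho> permutes ?J \<and> \<rho> ` W = U. w U W * perm_term ?J Q \<rho>) =
        (\<Sum>\<rho> | \<rho> permutes ?J. if \<rho> ` W = U then w U W * perm_term ?J Q \<rho> else 0)"
      by (simp flip: sum.inter_filter[OF finJ])
    then show "w U W * exchange_prod (\<kappa> U W) U (d \<cdot>\<^sub>m 1\<^sub>m r) Q = d ^ r *
        (\<Sum>\<rho> | \<rho> permutes ?J. if \<rho> ` W = U then w U W * perm_term ?J Q \<rho> else 0)"
      unfolding exchange_prod_scalar[OF Q p(3,1)] p(2)
      by (simp add: mult.left_commute flip: sum_distrib_left)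
  qed
  also have "\<dots> = d ^ r * (\<Sum>(U, W)\<in>?I. \<Sum>\<rho> | \<rho> permutes ?J. if \<rho> ` W = U then w U W * perm_term ?J Q \<rho> else 0)"
    by (simp add: sum_distrib_left case_prod_unfold)
  also have "(\<Sum>(U, W)\<in>?I. \<Sum>\<rho> | \<rho> permutes ?J. if \<rho> ` W = U then w U W * perm_term ?J Q \<rho> else 0) =
    (\<Sum>\<rho> | \<rho> permutes ?J. \<Sum>(U, W)\<in>?I. if \<rho> ` W = U then w U W * perm_term ?J Q \<rho> else 0)"
    unfolding case_prod_unfold by (rule sum.swap)
  also have "\<dots> = (\<Sum>\<rho> | \<rho> permutes ?J. perm_term ?J Q \<rho>)"
  proof (rule sum.cong[OF refl])
    fix \<rho> assume "\<rho> \<in> {\<rho>. \<rho> permutes ?J}"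
    then have r: "\<rho> permutes ?J" by simp
    show "(\<Sum>(U, W)\<in>?I. if \<rho> ` W = U then w U W * perm_term ?J Q \<rho> else 0) = perm_term ?J Q \<rho>"
    proof (cases "\<rho> permutes S")
      case True
      have inj: "inj \<rho>" using r by (rule permutes_inj)
      have "(\<Sum>(U, W)\<in>?I. if \<rho> ` W = U then w U W * perm_term ?J Q \<rho> else 0) =
        (\<Sum>(U, W)\<in>{x \<in> ?I. \<rho> ` snd x = fst x}. w U W * perm_term ?J Q \<rho>)"
        using finI unfolding case_prod_unfold by (rule sum.inter_filter[symmetric])
      also have "\<dots> = (\<Sum>W\<in>Pow S. w (\<rho> ` W) W * perm_term ?J Q \<rho>)"
        using permutes_image[OF True] card_image[OF inj_on_subset[OF inj subset_UNIV]]
        by (intro sum.reindex_bij_witness[of _ "\<lambda>W. (\<rho> ` W, W)" snd]) auto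
      also have "\<dots> = perm_term ?J Q \<rho>"
        using w[OF True] by (simp flip: sum_distrib_right)
      finally show ?thesis .
    next
      case False
      then obtain j where j: "j \<in> ?J - S" "\<rho> j \<noteq> j"
        using permutes_superset[OF r] by blast
      then have "Q $$ (\<rho> j, j) = 0"
        using permutes_in_image[OF r, of j] by (subst agree) auto
      then have "(\<Prod>j\<in>?J. Q $$ (\<rho> j, j)) = 0"
        using j by (intro prod_zero) auto
      then have "perm_term ?J Q \<rho> = 0" by (simp add: perm_term_def)
      then show ?thesis by (simp add: case_prod_unfold cong: if_cong)
    qed
  qed
  also have "\<dots> = det Q"
    by (subst det_col[OF Q]) (simp add: perm_term_def atLeast0LessThan)
  finally show ?thesis by simp
qed

lemma mult_mix_cols:
  fixes P Q R :: "'a::comm_ring_1 mat"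
  assumes "P \<in> carrier_mat r n" "Q \<in> carrier_mat r n" "R \<in> carrier_mat m r"
  shows "mix_cols U (R * P) (R * Q) = R * mix_cols U P Q"
  using assms by (intro eq_matI) (auto simp: mix_cols_def scalar_prod_def intro!: sum.cong)

lemma mult_permute_cols:
  fixes Q R :: "'a::comm_ring_1 mat"
  assumes "Q \<in> carrier_mat r n" "R \<in> carrier_mat m r" "\<kappa> permutes {0..<n}"
  shows "permute_cols \<kappa> (R * Q) = R * permute_cols \<kappa> Q"
  using assms permutes_in_image[OF assms(3)]
  by (intro eq_matI) (auto simp: permute_cols_def scalar_prod_def intro!: sum.cong)

lemma exchange_prod_mult:
  fixes P Q R :: "'a::comm_ring_1 mat"
  assumes P: "P \<in> carrier_mat r r" and Q: "Q \<in> carrier_mat r r" and R: "R \<in> carrier_mat r r"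
    and k: "\<kappa> permutes {0..<r}"
  shows "exchange_prod \<kappa> U (R * P) (R * Q) = det R ^ 2 * exchange_prod \<kappa> U P Q"
proof -
  note Q' = permute_cols_carrier[OF Q, of \<kappa>]
  show ?thesis
    unfolding exchange_prod_def mult_permute_cols[OF Q R k] mult_mix_cols[OF P Q' R]
      mult_mix_cols[OF Q' P R] det_mult[OF R mix_cols_carrier[OF P]] det_mult[OF R mix_cols_carrier[OF Q']]
    by (simp add: power2_eq_square mult_ac)
qed

lemma weighted_exchange_nonsingular:
  fixes P Q :: "'a::idom mat"
  assumes P: "P \<in> carrier_mat r r" and Q: "Q \<in> carrier_mat r r" and S: "S \<subseteq> {0..<r}"
    and agree: "\<And>i j. i < r \<Longrightarrow> j \<in> {0..<r} - S \<Longrightarrow> Q $$ (i, j) = P $$ (i, j)"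
    and k: "\<And>U W. U \<subseteq> S \<Longrightarrow> W \<subseteq> S \<Longrightarrow> card U = card W \<Longrightarrow> \<kappa> U W permutes S \<and> \<kappa> U W ` U = W"
    and w: "\<And>\<rho>. \<rho> permutes S \<Longrightarrow> (\<Sum>W\<in>Pow S. w (\<rho> ` W) W) = 1"
    and nz: "det P \<noteq> 0"
  shows "(\<Sum>(U, W)\<in>{(U, W). U \<subseteq> S \<and> W \<subseteq> S \<and> card U = card W}.
      w U W * exchange_prod (\<kappa> U W) U P Q) = det P * det Q"
proof -
  let ?R = "adj_mat P" and ?I = "{(U, W). U \<subseteq> S \<and> W \<subseteq> S \<and> card U = card W}"
  have R: "?R \<in> carrier_mat r r" and RP: "?R * P = det P \<cdot>\<^sub>m 1\<^sub>m r"
    using adj_mat[OF P] by auto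
  have "det ?R * det P = det P ^ r"
    using det_mult[OF R P] by (simp add: RP)
  then have nzR: "det ?R \<noteq> 0" using nz by auto
  have col: "(?R * Q) $$ (i, j) = (?R * P) $$ (i, j)" if "i < r" "j \<in> {0..<r} - S" for i j
  proof -
    have "col Q j = col P j"
      using agree that P Q by (intro eq_vecI) auto
    then show ?thesis using that P Q R by simp
  qed
  have "det ?R ^ 2 * (\<Sum>(U, W)\<in>?I. w U W * exchange_prod (\<kappa> U W) U P Q) =
     (\<Sum>(U, W)\<in>?I. w U W * exchange_prod (\<kappa> U W) U (?R * P) (?R * Q))"
    unfolding sum_distrib_left
  proof (rule sum.cong[OF refl], clarify)
    fix U W assume a: "U \<subseteq> S" "W \<subseteq> S" "card U = card W"
    have p: "\<kappa> U W permutes {0..<r}"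
      using k[OF a] S permutes_subset by blast
    show "det ?R ^ 2 * (w U W * exchange_prod (\<kappa> U W) U P Q) =
        w U W * exchange_prod (\<kappa> U W) U (?R * P) (?R * Q)"
      by (simp add: exchange_prod_mult[OF P Q R p])
  qed
  also have "\<dots> = det (?R * P) * det (?R * Q)"
    unfolding RP using R Q S col k w by (intro weighted_exchange_scalar) (auto simp: RP)
  also have "\<dots> = det ?R ^ 2 * (det P * det Q)"
    using det_mult[OF R P] det_mult[OF R Q] by (simp add: power2_eq_square)
  finally show ?thesis using nzR by simp
qed

lemma exchange_prod_poly:
  fixes P Q :: "'a::comm_ring_1 poly mat"
  assumes P: "P \<in> carrier_mat r r" and Q: "Q \<in> carrier_mat r r" and k: "\<kappa> permutes {0..<r}"
  shows "poly (exchange_prod \<kappa> U P Q) a =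
    exchange_prod \<kappa> U (map_mat (\<lambda>p. poly p a) P) (map_mat (\<lambda>p. poly p a) Q)"
proof -
  have c: "permute_cols \<kappa> (map_mat (\<lambda>p. poly p a) Q) = map_mat (\<lambda>p. poly p a) (permute_cols \<kappa> Q)"
    using Q permutes_in_image[OF k] by (intro eq_matI) (auto simp: permute_cols_def)
  have m: "mix_cols U (map_mat (\<lambda>p. poly p a) A) (map_mat (\<lambda>p. poly p a) B) = map_mat (\<lambda>p. poly p a) (mix_cols U A B)"
    if "A \<in> carrier_mat r r" "B \<in> carrier_mat r r" for A B :: "'a poly mat"
    using that by (intro eq_matI) (auto simp: mix_cols_def)
  have s: "poly (signof \<kappa>) a = signof \<kappa>"
    by (simp add: sign_def)
  show ?thesis
    using m[OF P permute_cols_carrier[OF Q, of \<kappa>]] m[OF permute_cols_carrier[OF Q, of \<kappa>] P]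
    by (simp add: exchange_prod_def c s flip: comm_ring_hom.hom_det[OF poly_hom.comm_ring_hom_axioms])
qed

text \<open>Replacing \<open>P\<close> by \<open>P + x I\<close>, with the common columns of \<open>Q\<close> changed accordingly, makes
  its determinant a monic polynomial in \<open>x\<close>; the general case is then obtained at \<open>x = 0\<close>.\<close>

lemma weighted_exchange:
  fixes P Q :: "'a::idom mat"
  assumes P: "P \<in> carrier_mat r r" and Q: "Q \<in> carrier_mat r r" and S: "S \<subseteq> {0..<r}"
    and agree: "\<And>i j. i < r \<Longrightarrow> j \<in> {0..<r} - S \<Longrightarrow> Q $$ (i, j) = P $$ (i, j)"
    and k: "\<And>U W. U \<subseteq> S \<Longrightarrow> W \<subseteq> S \<Longrightarrow> card U = card W \<Longrightarrow> \<kappa> U W permutes S \<and> \<kappa> U W ` U = W"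
    and w: "\<And>\<rho>. \<rho> permutes S \<Longrightarrow> (\<Sum>W\<in>Pow S. w (\<rho> ` W) W) = 1"
  shows "(\<Sum>(U, W)\<in>{(U, W). U \<subseteq> S \<and> W \<subseteq> S \<and> card U = card W}.
      w U W * exchange_prod (\<kappa> U W) U P Q) = det P * det Q"
proof -
  let ?I = "{(U, W). U \<subseteq> S \<and> W \<subseteq> S \<and> card U = card W}" and ?ev = "map_mat (\<lambda>p. poly p 0)"
  define P' where "P' = char_poly_matrix (- P)"
  define Q' where "Q' = mat r r (\<lambda>(i, j). if j \<in> S then [:Q $$ (i, j):] else P' $$ (i, j))"
  have P': "P' \<in> carrier_mat r r" and Q': "Q' \<in> carrier_mat r r"
    using P by (simp_all add: P'_def Q'_def)
  have evP: "?ev P' = P"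
    using P by (intro eq_matI) (auto simp: P'_def char_poly_matrix_def)
  have "poly (P' $$ (i, j)) 0 = P $$ (i, j)" if "i < r" "j < r" for i j
    using arg_cong[OF evP, of "\<lambda>A. A $$ (i, j)"] that P' by simp
  then have evQ: "?ev Q' = Q"
    using Q agree by (intro eq_matI) (auto simp: Q'_def)
  have "degree (det P') = r \<and> coeff (det P') r = 1"
    using degree_monic_char_poly[of "- P" r] P by (simp add: P'_def char_poly_def)
  then have nz: "det P' \<noteq> 0" by auto
  have "poly (\<Sum>(U, W)\<in>?I. [:w U W:] * exchange_prod (\<kappa> U W) U P' Q') 0 = poly (det P' * det Q') 0"
  proof (rule arg_cong[of _ _ "\<lambda>p. poly p 0"], rule weighted_exchange_nonsingular[OF P' Q' S _ k _ nz])
    show "Q' $$ (i, j) = P' $$ (i, j)" if "i < r" "j \<in> {0..<r} - S" for i j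
      using that by (simp add: Q'_def)
    show "(\<Sum>W\<in>Pow S. [:w (\<rho> ` W) W:]) = 1" if "\<rho> permutes S" for \<rho>
      using w[OF that] by (simp add: sum_to_poly one_pCons)
  qed auto
  moreover have "poly (\<Sum>(U, W)\<in>?I. [:w U W:] * exchange_prod (\<kappa> U W) U P' Q') 0 =
    (\<Sum>(U, W)\<in>?I. w U W * exchange_prod (\<kappa> U W) U P Q)"
    unfolding poly_sum
  proof (rule sum.cong[OF refl], clarify)
    fix U W assume a: "U \<subseteq> S" "W \<subseteq> S" "card U = card W"
    have p: "\<kappa> U W permutes {0..<r}"
      using k[OF a] S permutes_subset by blast
    show "poly ([:w U W:] * exchange_prod (\<kappa> U W) U P' Q') 0 = w U W * exchange_prod (\<kappa> U W) U P Q"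
      by (simp add: exchange_prod_poly[OF P' Q' p] evP evQ)
  qed
  moreover have "poly (det P' * det Q') 0 = det P * det Q"
    using evP evQ by (simp flip: comm_ring_hom.hom_det[OF poly_hom.comm_ring_hom_axioms])
  ultimately show ?thesis by simp
qed

section \<open>Counting and binomial coefficients\<close>

lemma card_subsets_containing:
  assumes "finite X" "Z \<subseteq> X"
  shows "card {W. W \<subseteq> X \<and> Z \<subseteq> W \<and> card W = n} =
    (if card Z \<le> n then card (X - Z) choose (n - card Z) else 0)"
proof (cases "card Z \<le> n")
  case True
  have fin: "finite Z" "finite (X - Z)" using assms finite_subset by auto
  have "bij_betw (\<lambda>V. Z \<union> V) {V. V \<subseteq> X - Z \<and> card V = n - card Z} {W. W \<subseteq> X \<and> Z \<subseteq> W \<and> card W = n}"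
  proof (rule bij_betw_byWitness[where f' = "\<lambda>W. W - Z"])
    show "(\<union>) Z ` {V. V \<subseteq> X - Z \<and> card V = n - card Z} \<subseteq> {W. W \<subseteq> X \<and> Z \<subseteq> W \<and> card W = n}"
    proof clarify
      fix V assume V: "V \<subseteq> X - Z" "card V = n - card Z"
      have "card (Z \<union> V) = card Z + card V"
        using V fin by (intro card_Un_disjoint) (auto intro: finite_subset)
      then show "Z \<union> V \<subseteq> X \<and> Z \<subseteq> Z \<union> V \<and> card (Z \<union> V) = n"
        using V assms True by auto
    qed
    show "(\<lambda>W. W - Z) ` {W. W \<subseteq> X \<and> Z \<subseteq> W \<and> card W = n} \<subseteq> {V. V \<subseteq> X - Z \<and> card V = n - card Z}"
      using fin by (auto simp: card_Diff_subset)
  qed auto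
  then show ?thesis
    using True fin by (simp add: n_subsets flip: bij_betw_same_card)
next
  case False
  have "card Z \<le> card W" if "W \<subseteq> X" "Z \<subseteq> W" for W
    using that assms(1) by (meson card_mono finite_subset)
  then have none: "{W. W \<subseteq> X \<and> Z \<subseteq> W \<and> card W = n} = {}" using False by fastforce
  show ?thesis unfolding none using False by simp
qed

lemma card_subsets_split:
  assumes S: "finite S" and X: "X \<subseteq> S" and Z: "Z \<subseteq> S"
  shows "card {W. W \<subseteq> S \<and> Z \<subseteq> W \<and> card (W \<inter> X) = p \<and> card (W - X) = k} =
    card {W. W \<subseteq> X \<and> Z \<inter> X \<subseteq> W \<and> card W = p} *
    card {W. W \<subseteq> S - X \<and> Z - X \<subseteq> W \<and> card W = k}"
proof -
  have "bij_betw (\<lambda>W. (W \<inter> X, W - X))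
     {W. W \<subseteq> S \<and> Z \<subseteq> W \<and> card (W \<inter> X) = p \<and> card (W - X) = k}
     ({W. W \<subseteq> X \<and> Z \<inter> X \<subseteq> W \<and> card W = p} \<times> {W. W \<subseteq> S - X \<and> Z - X \<subseteq> W \<and> card W = k})"
  proof (rule bij_betw_byWitness[where f' = "\<lambda>(U, V). U \<union> V"])
    show "(\<lambda>(U, V). U \<union> V) ` ({W. W \<subseteq> X \<and> Z \<inter> X \<subseteq> W \<and> card W = p} \<times>
        {W. W \<subseteq> S - X \<and> Z - X \<subseteq> W \<and> card W = k}) \<subseteq>
      {W. W \<subseteq> S \<and> Z \<subseteq> W \<and> card (W \<inter> X) = p \<and> card (W - X) = k}"
    proof clarify
      fix U V assume U: "U \<subseteq> X" "Z \<inter> X \<subseteq> U" and V: "V \<subseteq> S - X" "Z - X \<subseteq> V"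
      have "(U \<union> V) \<inter> X = U" "(U \<union> V) - X = V" using U V by auto
      then show "U \<union> V \<subseteq> S \<and> Z \<subseteq> U \<union> V \<and> card ((U \<union> V) \<inter> X) = card U \<and> card (U \<union> V - X) = card V"
        using U V X by auto
    qed
  qed (use X in auto)
  then show ?thesis
    by (simp add: bij_betw_same_card card_cartesian_product)
qed

lemma int_binom_of_nat: "int_binom (int n) (int k) = int (n choose k)"
proof -
  have "(of_int (int_binom (int n) (int k)) :: rat) = of_int (int (n choose k))"
    by (simp add: of_int_int_binom binomial_gbinomial)
  then show ?thesis by (simp only: of_int_eq_iff)
qed

lemma int_binom_Vandermonde:
  "(\<Sum>l = 0..n. int_binom a (int (n - l)) * int (b choose l)) = int_binom (a + int b) (int n)"
proof -
  have "(of_int (\<Sum>l = 0..n. int_binom a (int (n - l)) * int (b choose l)) :: rat) =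
    of_int (int_binom (a + int b) (int n))"
    using gbinomial_Vandermonde[of "of_nat b :: rat" "of_int a" n]
    by (simp add: of_int_int_binom binomial_gbinomial mult.commute add.commute del: of_nat_diff)
  then show ?thesis by (simp only: of_int_eq_iff)
qed

lemma int_binom_pred: "int_binom (int n - 1) (int n) = (if n = 0 then 1 else 0)"
proof (cases n)
  case (Suc k)
  then show ?thesis using int_binom_of_nat[of k n] by simp
qed (simp add: int_binom_def)

lemma int_binom_sum_delta:
  fixes x y m t i :: nat
  assumes "t \<le> y" "i \<le> y" "x + y \<le> m + t"
  shows "(\<Sum>k = 0..y - i. int_binom (int x + int y - int m - int i - 1) (int y - int k - int i) *
      int (if y - t \<le> k then (m + t - x - y) choose (k - (y - t)) else 0)) = (if i = t then 1 else 0)"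
    (is "sum ?f _ = _")
proof (cases "i \<le> t")
  case True
  have "sum ?f {0..y - i} = sum ?f {y - t..y - i}"
    by (rule sum.mono_neutral_right) auto
  also have "{y - t..y - i} = {0 + (y - t)..(t - i) + (y - t)}"
    using True assms by simp
  also have "sum ?f \<dots> = (\<Sum>l = 0..t - i. int_binom (int x + int y - int m - int i - 1) (int (t - i - l)) *
      int ((m + t - x - y) choose l))"
    unfolding sum.shift_bounds_cl_nat_ivl
  proof (intro sum.cong refl)
    fix l assume "l \<in> {0..t - i}"
    then have "int y - int (l + (y - t)) - int i = int (t - i - l)" "y - t \<le> l + (y - t)"
      "l + (y - t) - (y - t) = l"
      using assms True by auto
    then show "?f (l + (y - t)) = int_binom (int x + int y - int m - int i - 1) (int (t - i - l)) *
      int ((m + t - x - y) choose l)" by (simp only: if_True)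
  qed
  also have "\<dots> = int_binom (int (t - i) - 1) (int (t - i))"
    unfolding int_binom_Vandermonde using assms True by (intro arg_cong2[of _ _ _ _ int_binom]) auto
  finally show ?thesis unfolding int_binom_pred using True by auto
next
  case False
  then show ?thesis using assms by (auto intro!: sum.neutral)
qed

lemma sum_triangle_swap:
  fixes g :: "nat \<Rightarrow> nat \<Rightarrow> 'a::comm_monoid_add"
  shows "(\<Sum>k = 0..n. \<Sum>i = 0..n - k. g k i) = (\<Sum>i = 0..n. \<Sum>k = 0..n - i. g k i)"
proof -
  have "(\<Sum>k = 0..n. \<Sum>i = 0..n - k. g k i) = (\<Sum>k = 0..n. \<Sum>i\<in>{i \<in> {0..n}. k + i \<le> n}. g k i)"
    by (intro sum.cong refl) auto
  also have "\<dots> = (\<Sum>i = 0..n. \<Sum>k\<in>{k \<in> {0..n}. k + i \<le> n}. g k i)"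
    by (rule sum.swap_restrict) auto
  also have "\<dots> = (\<Sum>i = 0..n. \<Sum>k = 0..n - i. g k i)"
    by (intro sum.cong refl) auto
  finally show ?thesis .
qed

lemma weight_sum:
  fixes x y m t p :: nat
  assumes t: "t \<le> y" and yp: "y \<le> p" and px: "p \<le> x" and m: "x + y \<le> m + t"
    and nz: "of_int (int_binom (int x - int t) (int x - int p)) \<noteq> (0 :: 'a::field)"
  shows "(\<Sum>k = 0..y. \<Sum>i = 0..y - k.
      of_int (int_binom (int x + int y - int m - int i - 1) (int y - int k - int i)) /
      of_int (int_binom (int x - int i) (int x - int p)) *
      of_nat (((x - t) choose (p - t)) * (if y - t \<le> k then (m + t - x - y) choose (k - (y - t)) else 0))) = (1 :: 'a)"
proof -
  define a where "a i k = int_binom (int x + int y - int m - int i - 1) (int y - int k - int i)" for i k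
  define b where "b i = int_binom (int x - int i) (int x - int p)" for i
  define d where "d k = (if y - t \<le> k then (m + t - x - y) choose (k - (y - t)) else 0)" for k
  have "int x - int t = int (x - t)" "int x - int p = int (x - p)" "p - t \<le> x - t" "(x - t) - (p - t) = x - p"
    using t yp px by auto
  then have bt: "b t = int ((x - t) choose (p - t))"
    unfolding b_def by (metis binomial_symmetric int_binom_of_nat)
  have "(\<Sum>k = 0..y. \<Sum>i = 0..y - k. of_int (a i k) / of_int (b i) * of_nat (((x - t) choose (p - t)) * d k)) =
    (\<Sum>i = 0..y. \<Sum>k = 0..y - i. of_int (a i k) / of_int (b i) * of_nat (((x - t) choose (p - t)) * d k) :: 'a)"
    by (rule sum_triangle_swap)
  also have "\<dots> = (\<Sum>i = 0..y. of_int (b t) / of_int (b i) * of_int (\<Sum>k = 0..y - i. a i k * int (d k)))"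
    by (simp add: bt sum_distrib_left mult_ac)
  also have "\<dots> = (\<Sum>i = 0..y. if i = t then of_int (b t) / of_int (b i) else 0)"
    using int_binom_sum_delta[OF t _ m] by (intro sum.cong refl) (simp add: a_def d_def)
  also have "\<dots> = 1"
    using t nz by (simp add: b_def)
  finally show ?thesis by (simp only: a_def b_def d_def)
qed

section \<open>The exchange products\<close>

lemma exchange_index_in:
  assumes "finite U" "card U = card V" "u \<in> U"
  shows "exchange_index U V u \<in> V"
proof -
  have "card {x \<in> U. x < u} < card U"
    using assms by (intro psubset_card_mono) auto
  then show ?thesis
    using assms by (simp add: exchange_index_def pick_in_set_le)
qed

lemma exchange_index_inverse:
  assumes "finite U" "card U = card V" "u \<in> U"
  shows "exchange_index V U (exchange_index U V u) = u"
proof -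
  have "card {x \<in> U. x < u} < card V"
    using assms by (simp flip: assms(2)) (intro psubset_card_mono, auto)
  then show ?thesis
    using assms exchange_index_in[OF assms]
    by (simp add: exchange_index_def card_pick_le pick_card_in_set)
qed

lemma bij_betw_exchange_index:
  assumes "finite U" "finite V" "card U = card V"
  shows "bij_betw (exchange_index U V) U V"
  using assms exchange_index_in[of U V] exchange_index_in[of V U]
    exchange_index_inverse[of U V] exchange_index_inverse[of V U]
  by (intro bij_betw_byWitness[where f' = "exchange_index V U"]) auto

lemma bij_betw_pick:
  assumes "finite A"
  shows "bij_betw (pick A) {0..<card A} A"
proof -
  have "inj_on (pick A) {0..<card A}"
    using pick_mono_le[of _ A] by (intro linorder_inj_onI) fastforce+
  moreover from this have "pick A ` {0..<card A} = A"
    using assms pick_in_set_le[of _ A] by (intro card_subset_eq) (auto simp: card_image)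
  ultimately show ?thesis by (simp add: bij_betw_def)
qed

lemma det_permute_cols:
  fixes N :: "'a::comm_ring_1 mat"
  assumes N: "N \<in> carrier_mat r r" and p: "\<theta> permutes {0..<r}"
  shows "det (permute_cols \<theta> N) = signof \<theta> * det N"
proof -
  have "transpose_mat (permute_cols \<theta> N) = mat r r (\<lambda>(i, j). transpose_mat N $$ (\<theta> i, j))"
    using N permutes_in_image[OF p] by (intro eq_matI) (auto simp: permute_cols_def)
  then show ?thesis
    using det_transpose[OF permute_cols_carrier[OF N, of \<theta>]] det_transpose[OF N]
      det_permute_rows[OF transpose_carrier_mat[THEN iffD2, OF N] p] by simp
qed

lemma extend_to_permutation:
  assumes "finite S" "U \<subseteq> S" "W \<subseteq> S" "bij_betw f U W"
  obtains \<kappa> where "\<kappa> permutes S" "\<And>j. j \<in> U \<Longrightarrow> \<kappa> j = f j"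
proof -
  have fin: "finite U" "finite W" using assms finite_subset by auto
  have "card (S - U) = card (S - W)"
    using assms fin bij_betw_same_card[OF assms(4)] by (simp add: card_Diff_subset)
  then obtain g where g: "bij_betw g (S - U) (S - W)"
    using assms(1) finite_same_card_bij[of "S - U" "S - W"] by auto
  define \<kappa> where "\<kappa> x = (if x \<in> U then f x else if x \<in> S then g x else x)" for x
  have "bij_betw \<kappa> U W" "bij_betw \<kappa> (S - U) (S - W)"
    using assms(4) g bij_betw_cong[of U \<kappa> f] bij_betw_cong[of "S - U" \<kappa> g] by (auto simp: \<kappa>_def)
  then have "bij_betw \<kappa> (U \<union> (S - U)) (W \<union> (S - W))"
    by (rule bij_betw_combine) auto
  moreover have "U \<union> (S - U) = S" "W \<union> (S - W) = S" using assms by auto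
  ultimately have "\<kappa> permutes S"
    using assms(2) by (intro bij_imp_permutes) (auto simp: \<kappa>_def)
  then show ?thesis using that by (simp add: \<kappa>_def)
qed

lemma mu_eq_exchange_prod:
  fixes M :: "'a::comm_ring_1 mat"
  assumes M: "dim_row M = r" and A: "finite A" "card A = r" and B: "card B = r"
    and q: "bij_betw q {0..<r} B"
    and e: "\<epsilon> permutes {0..<r}" "\<And>j. j < r \<Longrightarrow> q (\<epsilon> j) = pick B j"
    and k: "\<kappa> permutes {0..<r}" "\<And>j. j < r \<Longrightarrow> pick A j \<in> U \<Longrightarrow> q (\<kappa> j) = exchange_index U V (pick A j)"
    and U: "U \<subseteq> A" and V: "V \<subseteq> B" and c: "card U = card V"
  shows "mu M A B U V = signof \<epsilon> * exchange_prod \<kappa> {j \<in> {0..<r}. pick A j \<in> U}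
    (mat r r (\<lambda>(i, j). M $$ (i, pick A j))) (mat r r (\<lambda>(i, j). M $$ (i, q j)))"
proof -
  define P where "P = mat r r (\<lambda>(i, j). M $$ (i, pick A j))"
  define Q where "Q = mat r r (\<lambda>(i, j). M $$ (i, q j))"
  define U' where "U' = {j \<in> {0..<r}. pick A j \<in> U}"
  have PQ: "P \<in> carrier_mat r r" "Q \<in> carrier_mat r r" by (simp_all add: P_def Q_def)
  have fin: "finite U" "finite V"
    using A U V q bij_betw_finite[OF q] by (auto intro: finite_subset)
  note kk = permutes_inverses[OF k(1)]
  have kr: "\<kappa> j < r" if "j < r" for j
    using permutes_in_image[OF k(1), of j] that by simp
  define \<theta> where "\<theta> = inv_into UNIV \<kappa> \<circ> \<epsilon>"
  have th: "\<theta> permutes {0..<r}"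
    unfolding \<theta>_def using permutes_compose[OF e(1) permutes_inv[OF k(1)]] .
  have thr: "\<theta> j < r" if "j < r" for j
    using permutes_in_image[OF th, of j] that by simp
  have qk: "q (\<kappa> (\<theta> j)) = pick B j" if "j < r" for j
    using e(2)[OF that] by (simp add: \<theta>_def kk)
  have 1: "exchange_cols M A U V = mix_cols U' P (permute_cols \<kappa> Q)"
    using k(2) M A kr
    by (intro eq_matI) (auto simp: exchange_cols_def mix_cols_def permute_cols_def P_def Q_def U'_def exchange_index_def)
  have ind: "exchange_index V U (pick B j) = (if \<theta> j \<in> U' then pick A (\<theta> j) else pick B j)" if j: "j < r" for j
  proof (cases "\<theta> j \<in> U'")
    case True
    then have "pick A (\<theta> j) \<in> U" "\<theta> j < r" by (auto simp: U'_def)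
    then have "exchange_index U V (pick A (\<theta> j)) = pick B j"
      using k(2)[of "\<theta> j"] qk[OF j] by simp
    then show ?thesis
      using exchange_index_inverse[OF fin(1) c \<open>pick A (\<theta> j) \<in> U\<close>] True by simp
  next
    case False
    have "pick B j \<notin> V"
    proof
      assume v: "pick B j \<in> V"
      let ?u = "exchange_index V U (pick B j)"
      have u: "?u \<in> U" "exchange_index U V ?u = pick B j"
        using exchange_index_in[OF fin(2) c[symmetric] v] exchange_index_inverse[OF fin(2) c[symmetric] v] by auto
      then have "?u \<in> pick A ` {0..<r}"
        using bij_betw_imp_surj_on[OF bij_betw_pick[OF A(1)]] U A(2) by auto
      then obtain l where l: "l < r" "pick A l = ?u" by auto
      then have "q (\<kappa> l) = q (\<kappa> (\<theta> j))"
        using k(2)[of l] u qk[OF j] by simp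
      then have "\<kappa> l = \<kappa> (\<theta> j)"
        using q kr[OF l(1)] kr[OF thr[OF j]] by (auto simp: bij_betw_def dest: inj_onD)
      then have "l = \<theta> j"
        using permutes_inj[OF k(1)] by (simp add: inj_eq)
      then show False using False l u by (simp add: U'_def)
    qed
    then show ?thesis using False by (simp add: exchange_index_def)
  qed
  have 2: "exchange_cols M B V U = permute_cols \<theta> (mix_cols U' (permute_cols \<kappa> Q) P)"
    using M B ind thr kr qk
    by (intro eq_matI) (auto simp: exchange_cols_def mix_cols_def permute_cols_def P_def Q_def)
  have "sign \<theta> = sign \<kappa> * sign \<epsilon>"
    using permutes_imp_permutation[OF _ k(1)] permutes_imp_permutation[OF _ e(1)]
    by (simp add: \<theta>_def sign_compose sign_inverse permutation_inverse)
  moreover have "det (exchange_cols M B V U) = signof \<theta> * det (mix_cols U' (permute_cols \<kappa> Q) P)"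
    unfolding 2 using PQ by (intro det_permute_cols[OF _ th]) simp
  ultimately show ?thesis
    unfolding mu_def exchange_prod_def 1 P_def[symmetric] Q_def[symmetric] U'_def[symmetric]
    by (simp add: mult_ac)
qed

lemma weighted_mu:
  fixes M :: "'a::idom mat"
  assumes M: "dim_row M = r" and A: "finite A" "card A = r" and B: "finite B" "card B = r"
    and w: "\<And>\<pi>. bij_betw \<pi> (A - B) (B - A) \<Longrightarrow> (\<Sum>U\<in>Pow (A - B). w U (\<pi> ` U)) = 1"
  shows "(\<Sum>(U, V)\<in>{(U, V). U \<subseteq> A - B \<and> V \<subseteq> B - A \<and> card U = card V}. w U V * mu M A B U V) =
    mu M A B {} {}"
proof -
  let ?J = "{0..<r}" and ?a = "pick A"
  define S where "S = {j \<in> ?J. ?a j \<in> A - B}"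
  have S: "S \<subseteq> ?J" and finS: "finite S" by (auto simp: S_def)
  have a: "bij_betw ?a ?J A" using bij_betw_pick[OF A(1)] A(2) by simp
  have im: "?a ` {j \<in> ?J. ?a j \<in> T} = A \<inter> T" for T
  proof -
    have "?a ` {j \<in> ?J. ?a j \<in> T} = ?a ` ?J \<inter> T" by auto
    then show ?thesis by (simp only: bij_betw_imp_surj_on[OF a])
  qed
  have "?J - S = {j \<in> ?J. ?a j \<in> - (A - B)}" by (auto simp: S_def)
  then have "?a ` S = A - B" "?a ` (?J - S) = A \<inter> B"
    using im[of "A - B"] im[of "- (A - B)"] by (auto simp: S_def)
  then have aS: "bij_betw ?a S (A - B)" and aC: "bij_betw ?a (?J - S) (A \<inter> B)"
    using bij_betw_subset[OF a] S by auto
  have "card (A - B) = card (B - A)"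
    using A B by (simp add: card_Diff_subset_Int Int_commute)
  then obtain h where h: "bij_betw h S (B - A)"
    using finite_same_card_bij[of S "B - A"] bij_betw_same_card[OF aS] finS B by auto
  define q where "q j = (if j \<in> S then h j else ?a j)" for j
  have qS: "bij_betw q S (B - A)"
    using h bij_betw_cong[of S q h] by (simp add: q_def)
  moreover have "bij_betw q (?J - S) (A \<inter> B)"
    using aC bij_betw_cong[of "?J - S" q ?a] by (simp add: q_def)
  ultimately have "bij_betw q (S \<union> (?J - S)) (B - A \<union> (A \<inter> B))"
    by (rule bij_betw_combine) auto
  moreover have "S \<union> (?J - S) = ?J" "B - A \<union> (A \<inter> B) = B" using S by auto
  ultimately have q: "bij_betw q ?J B" by simp
  have "bij_betw (inv_into ?J q \<circ> pick B) ?J ?J"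
    using bij_betw_pick[OF B(1)] bij_betw_inv_into[OF q] B(2) by (auto intro: bij_betw_trans)
  then obtain \<epsilon> where e: "\<epsilon> permutes ?J" "\<And>j. j \<in> ?J \<Longrightarrow> \<epsilon> j = (inv_into ?J q \<circ> pick B) j"
    by (rule extend_to_permutation[of ?J ?J ?J, rotated 3]) auto
  have qe: "q (\<epsilon> j) = pick B j" if "j < r" for j
    using e(2)[of j] that bij_betw_inv_into_right[OF q] pick_in_set_le[of j B] B(2) by simp
  define P where "P = mat r r (\<lambda>(i, j). M $$ (i, ?a j))"
  define Q where "Q = mat r r (\<lambda>(i, j). M $$ (i, q j))"
  have PQ: "P \<in> carrier_mat r r" "Q \<in> carrier_mat r r" by (simp_all add: P_def Q_def)
  have pos: "{j \<in> ?J. ?a j \<in> ?a ` U} = U" if "U \<subseteq> S" for U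
    using inj_on_image_mem_iff[OF bij_betw_imp_inj_on[OF a] _ subset_trans[OF that S]]
      subset_trans[OF that S] by auto
  have ex: "\<exists>\<kappa>. \<kappa> permutes S \<and> \<kappa> ` U = W \<and> mu M A B (?a ` U) (q ` W) = signof \<epsilon> * exchange_prod \<kappa> U P Q"
    if U: "U \<subseteq> S" and W: "W \<subseteq> S" and c: "card U = card W" for U W
  proof -
    have fin: "finite U" "finite W" using finS U W finite_subset by auto
    have bU: "bij_betw ?a U (?a ` U)" and bW: "bij_betw q W (q ` W)"
      using bij_betw_subset[OF aS U] bij_betw_subset[OF qS W] by auto
    have c': "card (?a ` U) = card (q ` W)"
      using bij_betw_same_card[OF bU] bij_betw_same_card[OF bW] c by simp
    have f: "bij_betw (inv_into W q \<circ> (exchange_index (?a ` U) (q ` W) \<circ> ?a)) U W"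
      using bU bij_betw_exchange_index[of "?a ` U" "q ` W"] bij_betw_inv_into[OF bW] fin c'
      by (auto intro!: bij_betw_trans)
    obtain \<kappa> where k: "\<kappa> permutes S"
      "\<And>j. j \<in> U \<Longrightarrow> \<kappa> j = (inv_into W q \<circ> (exchange_index (?a ` U) (q ` W) \<circ> ?a)) j"
      by (rule extend_to_permutation[OF finS U W f], rule that)
    then have kUW: "\<kappa> ` U = W"
      using bij_betw_imp_surj_on[OF f] image_cong[OF refl k(2)] by simp
    have "mu M A B (?a ` U) (q ` W) = signof \<epsilon> * exchange_prod \<kappa> {j \<in> ?J. ?a j \<in> ?a ` U} P Q"
      unfolding P_def Q_def
    proof (rule mu_eq_exchange_prod[OF M A B(2) q e(1) qe permutes_subset[OF k(1) S] _ _ _ c'])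
      show "?a ` U \<subseteq> A" "q ` W \<subseteq> B"
        using image_mono[OF U, of ?a] image_mono[OF W, of q] aS qS
        by (auto simp: bij_betw_imp_surj_on)
      fix j assume "j < r" "?a j \<in> ?a ` U"
      then have "j \<in> U" using pos[OF U] by auto
      moreover from this have "exchange_index (?a ` U) (q ` W) (?a j) \<in> q ` W"
        using exchange_index_in[OF _ c', of "?a j"] fin by simp
      ultimately show "q (\<kappa> j) = exchange_index (?a ` U) (q ` W) (?a j)"
        by (simp add: k(2) f_inv_into_f)
    qed simp
    then show ?thesis using k(1) kUW pos[OF U] by auto
  qed
  define \<kappa> where "\<kappa> U W = (SOME \<kappa>. \<kappa> permutes S \<and> \<kappa> ` U = W \<and>
      mu M A B (?a ` U) (q ` W) = signof \<epsilon> * exchange_prod \<kappa> U P Q)" for U W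
  have k: "\<kappa> U W permutes S \<and> \<kappa> U W ` U = W \<and>
      mu M A B (?a ` U) (q ` W) = signof \<epsilon> * exchange_prod (\<kappa> U W) U P Q"
    if "U \<subseteq> S" "W \<subseteq> S" "card U = card W" for U W
    unfolding \<kappa>_def by (rule someI_ex[OF ex[OF that]])
  have wS: "(\<Sum>W\<in>Pow S. w (?a ` \<rho> ` W) (q ` W)) = 1" if r: "\<rho> permutes S" for \<rho>
  proof -
    let ?f = "?a \<circ> \<rho>"
    have f: "bij_betw ?f S (A - B)"
      using bij_betw_trans[OF permutes_imp_bij[OF r] aS] .
    let ?g = "q \<circ> inv_into S ?f"
    have "(\<Sum>W\<in>Pow S. w (?a ` \<rho> ` W) (q ` W)) = (\<Sum>W\<in>Pow S. w (?f ` W) (?g ` ?f ` W))"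
    proof (intro sum.cong refl)
      fix W assume "W \<in> Pow S"
      then have "?g ` ?f ` W = q ` W"
        unfolding image_comp using inv_into_f_f[OF bij_betw_imp_inj_on[OF f]]
        by (intro image_cong) auto
      then show "w (?a ` \<rho> ` W) (q ` W) = w (?f ` W) (?g ` ?f ` W)"
        by (simp only: image_comp)
    qed
    also have "\<dots> = (\<Sum>U\<in>Pow (A - B). w U (?g ` U))"
      by (rule sum.reindex_bij_betw[OF bij_betw_image_Pow[OF f]])
    also have "\<dots> = 1"
      by (rule w) (rule bij_betw_trans[OF bij_betw_inv_into[OF f] qS])
    finally show ?thesis .
  qed
  let ?I = "{(U, W). U \<subseteq> S \<and> W \<subseteq> S \<and> card U = card W}"
  have "(\<Sum>(U, V)\<in>{(U, V). U \<subseteq> A - B \<and> V \<subseteq> B - A \<and> card U = card V}. w U V * mu M A B U V) =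
    (\<Sum>(U, W)\<in>?I. w (?a ` U) (q ` W) * mu M A B (?a ` U) (q ` W))"
  proof (rule sum.reindex_bij_witness[of _ "\<lambda>(U, W). (?a ` U, q ` W)"
        "\<lambda>(U, V). (inv_into S ?a ` U, inv_into S q ` V)"])
    note aq = bij_betw_imp_surj_on[OF aS] bij_betw_imp_inj_on[OF aS]
      bij_betw_imp_surj_on[OF qS] bij_betw_imp_inj_on[OF qS]
    note inv = bij_betw_imp_surj_on[OF bij_betw_inv_into[OF aS]] bij_betw_imp_inj_on[OF bij_betw_inv_into[OF aS]]
      bij_betw_imp_surj_on[OF bij_betw_inv_into[OF qS]] bij_betw_imp_inj_on[OF bij_betw_inv_into[OF qS]]
    fix x assume "x \<in> {(U, V). U \<subseteq> A - B \<and> V \<subseteq> B - A \<and> card U = card V}"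
    then obtain U V where x: "x = (U, V)" "U \<subseteq> A - B" "V \<subseteq> B - A" "card U = card V" by auto
    have c: "?a ` inv_into S ?a ` U = U" "q ` inv_into S q ` V = V"
      using image_inv_into_cancel[OF aq(1) x(2)] image_inv_into_cancel[OF aq(3) x(3)] by auto
    then show "(\<lambda>(U, W). (?a ` U, q ` W)) ((\<lambda>(U, V). (inv_into S ?a ` U, inv_into S q ` V)) x) = x"
      by (simp add: x(1))
    have "inv_into S ?a ` U \<subseteq> S" "inv_into S q ` V \<subseteq> S"
      using image_mono[OF x(2), of "inv_into S ?a"] image_mono[OF x(3), of "inv_into S q"] inv(1,3) by auto
    moreover have "card (inv_into S ?a ` U) = card (inv_into S q ` V)"
      using card_image[OF inj_on_subset[OF inv(2) x(2)]] card_image[OF inj_on_subset[OF inv(4) x(3)]] x(4) by simp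
    ultimately show "(\<lambda>(U, V). (inv_into S ?a ` U, inv_into S q ` V)) x \<in> ?I"
      by (simp add: x(1))
    show "(case (\<lambda>(U, V). (inv_into S ?a ` U, inv_into S q ` V)) x of
        (U, W) \<Rightarrow> w (?a ` U) (q ` W) * mu M A B (?a ` U) (q ` W)) = (case x of (U, V) \<Rightarrow> w U V * mu M A B U V)"
      by (simp add: x(1) c)
  next
    note aq = bij_betw_imp_surj_on[OF aS] bij_betw_imp_inj_on[OF aS]
      bij_betw_imp_surj_on[OF qS] bij_betw_imp_inj_on[OF qS]
    fix y assume "y \<in> ?I"
    then obtain U W where y: "y = (U, W)" "U \<subseteq> S" "W \<subseteq> S" "card U = card W" by auto
    then show "(\<lambda>(U, V). (inv_into S ?a ` U, inv_into S q ` V)) ((\<lambda>(U, W). (?a ` U, q ` W)) y) = y"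
      using inv_into_image_cancel[OF aq(2)] inv_into_image_cancel[OF aq(4)] by simp
    have "card (?a ` U) = card (q ` W)"
      using card_image[OF inj_on_subset[OF aq(2) y(2)]] card_image[OF inj_on_subset[OF aq(4) y(3)]] y(4) by simp
    then show "(\<lambda>(U, W). (?a ` U, q ` W)) y \<in> {(U, V). U \<subseteq> A - B \<and> V \<subseteq> B - A \<and> card U = card V}"
      using y image_mono[OF y(2), of ?a] image_mono[OF y(3), of q] aq(1,3) by auto
  qed
  also have "\<dots> = (\<Sum>(U, W)\<in>?I. signof \<epsilon> * (w (?a ` U) (q ` W) * exchange_prod (\<kappa> U W) U P Q))"
    using k by (intro sum.cong) (auto simp: mult_ac)
  also have "\<dots> = signof \<epsilon> * (\<Sum>(U, W)\<in>?I. w (?a ` U) (q ` W) * exchange_prod (\<kappa> U W) U P Q)"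
    by (simp add: sum_distrib_left case_prod_unfold)
  also have "(\<Sum>(U, W)\<in>?I. w (?a ` U) (q ` W) * exchange_prod (\<kappa> U W) U P Q) = det P * det Q"
    using k wS by (intro weighted_exchange[OF PQ S]) (auto simp: P_def Q_def q_def)
  also have "signof \<epsilon> * (det P * det Q) = signof \<epsilon> * exchange_prod id {} P Q"
  proof -
    have "permute_cols id Q = Q" "mix_cols {} P Q = P" "mix_cols {} Q P = Q"
      using PQ by (auto simp: permute_cols_def mix_cols_def intro!: eq_matI)
    then show ?thesis by (simp add: exchange_prod_def)
  qed
  also have "\<dots> = mu M A B {} {}"
    using mu_eq_exchange_prod[OF M A B(2) q e(1) qe permutes_id, of "{}" "{}"] by (simp add: P_def Q_def)
  finally show ?thesis .
qed

lemma of_int_nonzero_if_not_cong: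
  assumes "c = CHAR('a::ring_1)" "c = 0 \<or> \<not> [z = 0] (mod (int c))" "z \<noteq> 0"
  shows "of_int z \<noteq> (0 :: 'a)"
  using assms by (auto simp: of_int_eq_0_iff_char_dvd cong_0_iff)

theorem theorem5p1:
  fixes M :: "'a::field mat"
    and r n c :: nat
    and A B X Y :: "nat set"
    and p :: int
  assumes "c = CHAR('a)"
    and "M \<in> carrier_mat r n"
    and "A \<subseteq> {0..<n}" and "B \<subseteq> {0..<n}"
    and "card A = r" and "card B = r"
    and "X \<subseteq> A - B" and "Y \<subseteq> B - A"
    and "int (card Y) \<le> p" and "p \<le> int (card X)"
    and "c = 0 \<or>
      (\<forall>i\<in>{0..card Y}.
         \<not> [int_binom (int (card X) - int i) (int (card X) - p) = 0] (mod (int c)))"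
  shows "mu M A B {} {} =
    (\<Sum>k = 0..card Y. \<Sum>i = 0..card Y - k.
       of_int (int_binom (int (card (X \<union> Y)) - int (card (A - B)) - int i - 1)
                         (int (card Y) - int k - int i))
       / of_int (int_binom (int (card X) - int i) (int (card X) - p))
       * (\<Sum>(U, V) \<in> {(U, V).
            U \<subseteq> A - B \<and> int (card U) = p + int k \<and> int (card (U \<inter> X)) = p \<and>
            V \<subseteq> B - A \<and> int (card V) = p + int k \<and> Y \<subseteq> V}.
            mu M A B U V))"
proof -
  define S T where "S = A - B" and "T = B - A"
  have finAB: "finite A" "finite B"
    using assms(3,4) finite_subset[of _ "{0..<n}"] by auto
  have XS: "X \<subseteq> S" and YT: "Y \<subseteq> T" and disj: "X \<inter> Y = {}"
    using assms(7,8) by (auto simp: S_def T_def)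
  then have fin: "finite A" "finite B" "finite X" "finite Y" "finite S" "finite T"
    using finAB by (auto simp: S_def T_def intro: finite_subset)
  obtain p' where p: "p = int p'"
    using assms(9) nonneg_int_cases[of p] by auto
  define coef :: "nat \<Rightarrow> nat \<Rightarrow> 'a" where "coef k i =
    of_int (int_binom (int (card (X \<union> Y)) - int (card (A - B)) - int i - 1) (int (card Y) - int k - int i))
       / of_int (int_binom (int (card X) - int i) (int (card X) - p))" for k i
  define adm where "adm k U V \<longleftrightarrow> card U = p' + k \<and> card (U \<inter> X) = p' \<and> card V = p' + k \<and> Y \<subseteq> V" for k U V
  define w where "w U V = (\<Sum>k = 0..card Y. \<Sum>i = 0..card Y - k. coef k i * of_bool (adm k U V))" for U V
  have "(\<Sum>U\<in>Pow S. w U (\<pi> ` U)) = 1" if pi: "bij_betw \<pi> S T" for \<pi>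
  proof -
    define Z where "Z = {s \<in> S. \<pi> s \<in> Y}"
    define t where "t = card (Z \<inter> X)"
    have "\<pi> ` Z = Y"
      using bij_betw_imp_surj_on[OF pi] YT by (auto simp: Z_def)
    then have bZ: "bij_betw \<pi> Z Y"
      using bij_betw_subset[OF pi, of Z] by (auto simp: Z_def)
    have Z: "Z \<subseteq> S" "finite Z" "card Z = card Y"
      using bij_betw_same_card[OF bZ] fin by (auto simp: Z_def)
    have ZX: "card (Z - X) = card Y - t"
      using Z fin card_Diff_subset_Int[of Z X] by (simp add: t_def)
    have ty: "t \<le> card Y"
      using card_mono[of Z "Z \<inter> X"] Z by (simp add: t_def)
    have "card (Z - X) \<le> card (S - X)"
      using Z fin by (intro card_mono) auto
    moreover have SX: "card (S - X) = card S - card X" "card X \<le> card S"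
      using XS fin by (auto simp: card_Diff_subset card_mono)
    ultimately have m: "card X + card Y \<le> card S + t"
      using ZX ty by simp
    have px: "p' \<le> card X" "card Y \<le> p'" using assms(9,10) p by auto
    have "(card X - t) choose (card X - p') \<noteq> 0" using ty px by simp
    moreover have "int_binom (int (card X) - int t) (int (card X) - int p') = int ((card X - t) choose (card X - p'))"
      using int_binom_of_nat[of "card X - t" "card X - p'"] ty px by (simp add: of_nat_diff)
    ultimately have "int_binom (int (card X) - int t) (int (card X) - int p') \<noteq> 0" by simp
    moreover have "c = 0 \<or> \<not> [int_binom (int (card X) - int t) (int (card X) - int p') = 0] (mod (int c))"
      using assms(11) ty p by auto
    ultimately have nz: "of_int (int_binom (int (card X) - int t) (int (card X) - int p')) \<noteq> (0 :: 'a)"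
      by (intro of_int_nonzero_if_not_cong[OF assms(1)])
    have count: "card {U \<in> Pow S. adm k U (\<pi> ` U)} = ((card X - t) choose (p' - t)) *
        (if card Y - t \<le> k then (card S + t - card X - card Y) choose (k - (card Y - t)) else 0)" for k
    proof -
      have "{U \<in> Pow S. adm k U (\<pi> ` U)} = {U. U \<subseteq> S \<and> Z \<subseteq> U \<and> card (U \<inter> X) = p' \<and> card (U - X) = k}"
      proof (rule Collect_cong)
        fix U
        have "adm k U (\<pi> ` U) \<longleftrightarrow> Z \<subseteq> U \<and> card (U \<inter> X) = p' \<and> card (U - X) = k" if U: "U \<subseteq> S"
        proof -
          have inj: "inj_on \<pi> U" using bij_betw_imp_inj_on[OF pi] U by (rule inj_on_subset)
          have "Y \<subseteq> \<pi> ` U \<longleftrightarrow> Z \<subseteq> U"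
          proof
            assume "Y \<subseteq> \<pi> ` U"
            then show "Z \<subseteq> U"
              using inj_on_image_mem_iff[OF bij_betw_imp_inj_on[OF pi] _ U] by (auto simp: Z_def)
          qed (use \<open>\<pi> ` Z = Y\<close> in blast)
          moreover have "card U = card (U \<inter> X) + card (U - X)"
            using U fin by (metis card_Int_Diff finite_subset)
          ultimately show ?thesis
            using card_image[OF inj] by (auto simp: adm_def)
        qed
        then show "U \<in> Pow S \<and> adm k U (\<pi> ` U) \<longleftrightarrow>
            U \<subseteq> S \<and> Z \<subseteq> U \<and> card (U \<inter> X) = p' \<and> card (U - X) = k" by auto
      qed
      moreover have "card (X - Z \<inter> X) = card X - t"
        using fin by (simp add: t_def card_Diff_subset)
      moreover have "S - X - (Z - X) = S - X - Z" by auto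
      moreover have "card (S - X - (Z - X)) = card S + t - card X - card Y"
        using fin Z ZX SX ty m by (subst card_Diff_subset) auto
      moreover have "t \<le> p'" using ty px by simp
      ultimately show ?thesis
        using card_subsets_split[OF fin(5) XS Z(1)] card_subsets_containing[of X "Z \<inter> X"]
          card_subsets_containing[of "S - X" "Z - X"] fin Z ZX
        by (simp add: t_def[symmetric] Diff_mono)
    qed
    have "(\<Sum>U\<in>Pow S. w U (\<pi> ` U)) =
      (\<Sum>k = 0..card Y. \<Sum>i = 0..card Y - k. \<Sum>U\<in>Pow S. coef k i * of_bool (adm k U (\<pi> ` U)))"
      unfolding w_def by (subst sum.swap, intro sum.cong refl, rule sum.swap)
    also have "\<dots> = (\<Sum>k = 0..card Y. \<Sum>i = 0..card Y - k. coef k i * of_nat (card {U \<in> Pow S. adm k U (\<pi> ` U)}))"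
      using fin by (simp add: sum_of_bool_eq Int_def flip: sum_distrib_left)
    also have "\<dots> = 1"
    proof -
      have "card (X \<union> Y) = card X + card Y" using fin disj by (simp add: card_Un_disjoint)
      then show ?thesis
        unfolding count coef_def p S_def[symmetric] using weight_sum[OF ty px(2,1) m nz] by simp
    qed
    finally show ?thesis .
  qed
  then have "mu M A B {} {} =
      (\<Sum>(U, V)\<in>{(U, V). U \<subseteq> A - B \<and> V \<subseteq> B - A \<and> card U = card V}. w U V * mu M A B U V)"
    using assms fin by (intro weighted_mu[symmetric]) (auto simp: S_def T_def)
  also have "\<dots> = (\<Sum>k = 0..card Y. \<Sum>i = 0..card Y - k.
      \<Sum>(U, V)\<in>{(U, V). U \<subseteq> A - B \<and> V \<subseteq> B - A \<and> card U = card V}. coef k i * (of_bool (adm k U V) * mu M A B U V))"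
    unfolding w_def case_prod_unfold sum_distrib_right mult.assoc
    by (subst sum.swap, intro sum.cong refl, rule sum.swap)
  also have "\<dots> = (\<Sum>k = 0..card Y. \<Sum>i = 0..card Y - k. coef k i *
      (\<Sum>(U, V) \<in> {(U, V). U \<subseteq> A - B \<and> int (card U) = p + int k \<and> int (card (U \<inter> X)) = p \<and>
            V \<subseteq> B - A \<and> int (card V) = p + int k \<and> Y \<subseteq> V}. mu M A B U V))"
  proof (intro sum.cong refl)
    fix k i
    let ?I = "{(U, V). U \<subseteq> A - B \<and> V \<subseteq> B - A \<and> card U = card V}"
    have finI: "finite ?I"
      by (rule finite_subset[of _ "Pow S \<times> Pow T"]) (use fin in \<open>auto simp: S_def T_def\<close>)
    have "(\<Sum>(U, V)\<in>?I. of_bool (adm k U V) * mu M A B U V) = (\<Sum>(U, V)\<in>{(U, V). U \<subseteq> A - B \<and> int (card U) = p + int k \<and> int (card (U \<inter> X)) = p \<and>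
            V \<subseteq> B - A \<and> int (card V) = p + int k \<and> Y \<subseteq> V}. mu M A B U V)"
      using finI by (intro sum.mono_neutral_cong_right) (auto simp: adm_def p)
    then show "(\<Sum>(U, V)\<in>?I. coef k i * (of_bool (adm k U V) * mu M A B U V)) = coef k i *
      (\<Sum>(U, V) \<in> {(U, V). U \<subseteq> A - B \<and> int (card U) = p + int k \<and> int (card (U \<inter> X)) = p \<and>
            V \<subseteq> B - A \<and> int (card V) = p + int k \<and> Y \<subseteq> V}. mu M A B U V)"
      by (simp add: case_prod_unfold flip: sum_distrib_left)
  qed
  finally show ?thesis by (simp only: coef_def)
qed

end
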